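(* Let $\mathbf t=(t_0,u_0,t_1,u_1)\in\mathbb C^4$ with $t_0,t_1\ne0$ and $t_0+t_1\notin-\frac12\mathbb N$. The algebra $\mathcal H(\mathbf t)$ is isomorphic to the unital, associative complex algebra $\mathcal V(\mathbf t)$ generated by $V_i,\widetilde V_i$, $i=0,1$, with relations $$V_i^2=t_i^2,\qquad \widetilde V_i^2=u_i^2\qquad(i=0,1),\qquad V_0+V_1+\widetilde V_0+\widetilde V_1=-\tfrac12 .$$ The isomorphism is given explicitly on generators by $V_i\mapsto T_i$, $\widetilde V_i\mapsto U_i$, $i=0,1$.
   Context: $\mathbb N=\{1,2,\dots\}$; $\mathcal A=\mathbb C[x]$. Operators on $\mathcal A$: $$(T_0f)(x)=t_0f(x)+\frac{(t_0+u_0+\frac12-x)(t_0-u_0+\frac12-x)}{1-2x}\big(f(1-x)-f(x)\big),$$ $$(T_1f)(x)=t_1f(x)+\frac{(t_1+u_1+x)(t_1-u_1+x)}{2x}\big(f(-x)-f(x)\big),$$ both preserving $\mathcal A$; $z\in\mathrm{End}(\mathcal A)$ is multiplication by $x$. $\mathcal H(\mathbf t)$ is the (unital) subalgebra of $\mathrm{End}(\mathcal A)$ generated by $T_0,T_1,z$. Further $U_0=-T_0-\frac12+z$ and $U_1=-T_1-z$. Scalars are identified with scalar multiples of the identity. *)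

theory Defs
  imports
    Complex_Main
    "HOL-Computational_Algebra.Polynomial"
    "HOL-Library.Poly_Mapping"
    "HOL-Algebra.QuotRing"
    "HOL-Algebra.Module"
    "HOL-Algebra.Subrings"
begin

section \<open>Unital associative algebras\<close>

text \<open>
  The record \<^type>\<open>module_ext\<close> carries both a ring structure and a scalar multiplication. All
  algebras below are such records with scalars in \<^typ>\<open>complex\<close>. (The locale \<^locale>\<open>algebra\<close> is
  of no use here because it requires commutativity.)
\<close>

definition algebra_iso ::
    "('k, 'a, 'm) module_scheme \<Rightarrow> ('k, 'b, 'n) module_scheme \<Rightarrow> ('a \<Rightarrow> 'b) set" where
  "algebra_iso A B =
     {h \<in> ring_iso A B. \<forall>c. \<forall>x \<in> carrier A. h (c \<odot>\<^bsub>A\<^esub> x) = c \<odot>\<^bsub>B\<^esub> h x}"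

definition unital_subalgebra :: "'a set \<Rightarrow> ('k, 'a, 'm) module_scheme \<Rightarrow> bool" where
  "unital_subalgebra S A \<longleftrightarrow> subring S A \<and> (\<forall>c. \<forall>x \<in> S. c \<odot>\<^bsub>A\<^esub> x \<in> S)"

definition generated_subalgebra ::
    "('k, 'a, 'm) module_scheme \<Rightarrow> 'a set \<Rightarrow> ('k, 'a, 'm) module_scheme" where
  "generated_subalgebra A X = A\<lparr>carrier := \<Inter>{S. unital_subalgebra S A \<and> X \<subseteq> S}\<rparr>"

definition quotient_algebra ::
    "('k, 'a, 'm) module_scheme \<Rightarrow> 'a set \<Rightarrow> ('k, 'a set) module" where
  "quotient_algebra A I =
     ring.extend (A Quot I) (module.fields (\<lambda>c X. \<Union>x\<in>X. I +>\<^bsub>A\<^esub> (c \<odot>\<^bsub>A\<^esub> x)))"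


section \<open>Free algebras\<close>

datatype 'a free_mon = Word (letters: "'a list")

text \<open>Words under concatenation, written additively so that \<^typ>\<open>'a free_mon \<Rightarrow>\<^sub>0 complex\<close>
  with its convolution product is the monoid algebra, i.e. the free algebra.\<close>

instantiation free_mon :: (type) monoid_add
begin

definition zero_free_mon :: "'a free_mon" where
  "0 = Word []"

definition plus_free_mon :: "'a free_mon \<Rightarrow> 'a free_mon \<Rightarrow> 'a free_mon" where
  "v + w = Word (letters v @ letters w)"

instance
  by standard (auto simp: zero_free_mon_def plus_free_mon_def)

end

definition scalar :: "complex \<Rightarrow> ('a free_mon \<Rightarrow>\<^sub>0 complex)" where
  "scalar c = Poly_Mapping.single 0 c"

definition gen :: "'a \<Rightarrow> ('a free_mon \<Rightarrow>\<^sub>0 complex)" where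
  "gen a = Poly_Mapping.single (Word [a]) 1"

definition free_algebra :: "(complex, 'a free_mon \<Rightarrow>\<^sub>0 complex) module" where
  "free_algebra =
     \<lparr>carrier = UNIV, mult = (*), one = 1, zero = 0, add = (+), smult = (\<lambda>c p. scalar c * p)\<rparr>"

definition presented_algebra ::
    "('a free_mon \<Rightarrow>\<^sub>0 complex) set \<Rightarrow> (complex, ('a free_mon \<Rightarrow>\<^sub>0 complex) set) module" where
  "presented_algebra rels = quotient_algebra free_algebra (Idl\<^bsub>free_algebra\<^esub> rels)"

definition presented_gen ::
    "('a free_mon \<Rightarrow>\<^sub>0 complex) set \<Rightarrow> 'a \<Rightarrow> ('a free_mon \<Rightarrow>\<^sub>0 complex) set" where
  "presented_gen rels a = (Idl\<^bsub>free_algebra\<^esub> rels) +>\<^bsub>free_algebra\<^esub> gen a"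


section \<open>The algebra \<open>\<V>(t)\<close>\<close>

text \<open>\<open>Vt0\<close> and \<open>Vt1\<close> stand for the generators with a tilde.\<close>

datatype V_gen = V0 | V1 | Vt0 | Vt1

definition V_rels ::
    "complex \<Rightarrow> complex \<Rightarrow> complex \<Rightarrow> complex \<Rightarrow> (V_gen free_mon \<Rightarrow>\<^sub>0 complex) set" where
  "V_rels t0 u0 t1 u1 =
     {gen V0 ^ 2 - scalar (t0\<^sup>2), gen V1 ^ 2 - scalar (t1\<^sup>2),
      gen Vt0 ^ 2 - scalar (u0\<^sup>2), gen Vt1 ^ 2 - scalar (u1\<^sup>2),
      gen V0 + gen V1 + gen Vt0 + gen Vt1 - scalar (- 1 / 2)}"

definition V_alg ::
    "complex \<Rightarrow> complex \<Rightarrow> complex \<Rightarrow> complex \<Rightarrow>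
     (complex, (V_gen free_mon \<Rightarrow>\<^sub>0 complex) set) module" where
  "V_alg t0 u0 t1 u1 = presented_algebra (V_rels t0 u0 t1 u1)"


section \<open>The algebra \<open>\<H>(t)\<close>\<close>

definition End_alg :: "(complex, complex poly \<Rightarrow> complex poly) module" where
  "End_alg =
     \<lparr>carrier = {F. Vector_Spaces.linear Polynomial.smult Polynomial.smult F},
      mult = (\<circ>), one = id, zero = (\<lambda>f. 0), add = (\<lambda>F G f. F f + G f),
      smult = (\<lambda>c F f. Polynomial.smult c (F f))\<rparr>"

text \<open>The divisions in \<open>T0_op\<close> and \<open>T1_op\<close> are exact; see \<open>poly_T0_op\<close> and \<open>poly_T1_op\<close>.\<close>

definition T0_op :: "complex \<Rightarrow> complex \<Rightarrow> complex poly \<Rightarrow> complex poly" where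
  "T0_op t0 u0 f = Polynomial.smult t0 f +
     ([:t0 + u0 + 1/2, - 1:] * [:t0 - u0 + 1/2, - 1:] * (pcompose f [:1, - 1:] - f)) div [:1, - 2:]"

definition T1_op :: "complex \<Rightarrow> complex \<Rightarrow> complex poly \<Rightarrow> complex poly" where
  "T1_op t1 u1 f = Polynomial.smult t1 f +
     ([:t1 + u1, 1:] * [:t1 - u1, 1:] * (pcompose f [:0, - 1:] - f)) div [:0, 2:]"

definition z_op :: "complex poly \<Rightarrow> complex poly" where
  "z_op f = [:0, 1:] * f"

definition U0_op :: "complex \<Rightarrow> complex \<Rightarrow> complex poly \<Rightarrow> complex poly" where
  "U0_op t0 u0 f = - T0_op t0 u0 f - Polynomial.smult (1/2) f + z_op f"

definition U1_op :: "complex \<Rightarrow> complex \<Rightarrow> complex poly \<Rightarrow> complex poly" where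
  "U1_op t1 u1 f = - T1_op t1 u1 f - z_op f"

definition H_alg ::
    "complex \<Rightarrow> complex \<Rightarrow> complex \<Rightarrow> complex \<Rightarrow>
     (complex, complex poly \<Rightarrow> complex poly) module" where
  "H_alg t0 u0 t1 u1 = generated_subalgebra End_alg {T0_op t0 u0, T1_op t1 u1, z_op}"


section \<open>Basic facts\<close>

lemma T0_div:
  fixes f :: "complex poly"
  shows "[:1, - 2:] dvd pcompose f [:1, - 1:] - f"
proof -
  have "[:- (1/2), 1:] dvd pcompose f [:1, - 1:] - f"
    by (simp add: poly_eq_0_iff_dvd[symmetric] poly_pcompose)
  moreover have "[:1, - 2:] = Polynomial.smult (- 2) [:- (1/2), 1 :: complex:]" by simp
  ultimately show ?thesis by (metis smult_dvd neg_equal_0_iff_equal zero_neq_numeral)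
qed

lemma T1_div:
  fixes f :: "complex poly"
  shows "[:0, 2:] dvd pcompose f [:0, - 1:] - f"
proof -
  have "[:- 0, 1:] dvd pcompose f [:0, - 1:] - f"
    by (simp only: poly_eq_0_iff_dvd[symmetric]) (simp add: poly_pcompose)
  moreover have "[:0, 2:] = Polynomial.smult 2 [:- 0, 1 :: complex:]" by simp
  ultimately show ?thesis by (metis smult_dvd zero_neq_numeral)
qed

lemma poly_T0_op:
  assumes "x \<noteq> 1/2"
  shows "poly (T0_op t0 u0 f) x = t0 * poly f x +
    (t0 + u0 + 1/2 - x) * (t0 - u0 + 1/2 - x) / (1 - 2 * x) * (poly f (1 - x) - poly f x)"
proof -
  let ?p = "[:t0 + u0 + 1/2, - 1:] * [:t0 - u0 + 1/2, - 1:] * (pcompose f [:1, - 1:] - f)"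
  have "?p = ?p div [:1, - 2:] * [:1, - 2:]"
    by (rule dvd_div_mult_self[OF dvd_mult[OF T0_div], symmetric])
  then have "poly ?p x = poly (?p div [:1, - 2:]) x * poly [:1, - 2:] x"
    by (metis poly_mult)
  also have "poly [:1, - 2:] x = (1 - 2 * x)" by simp
  finally have *: "poly ?p x = poly (?p div [:1, - 2:]) x * (1 - 2 * x)" .
  have "1 - 2 * x \<noteq> 0" using assms by (auto simp: field_simps)
  then have "poly (?p div [:1, - 2:]) x = poly ?p x / (1 - 2 * x)"
    using * by (metis nonzero_mult_div_cancel_right)
  moreover have "poly ?p x = (t0 + u0 + 1/2 - x) * (t0 - u0 + 1/2 - x) * (poly f (1 - x) - poly f x)"
    by (simp only: poly_mult poly_diff poly_pcompose) simp
  ultimately show ?thesis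
    by (simp only: T0_op_def poly_add poly_smult) simp
qed

lemma poly_T1_op:
  assumes "x \<noteq> 0"
  shows "poly (T1_op t1 u1 f) x = t1 * poly f x +
    (t1 + u1 + x) * (t1 - u1 + x) / (2 * x) * (poly f (- x) - poly f x)"
proof -
  let ?p = "[:t1 + u1, 1:] * [:t1 - u1, 1:] * (pcompose f [:0, - 1:] - f)"
  have "?p = ?p div [:0, 2:] * [:0, 2:]"
    by (rule dvd_div_mult_self[OF dvd_mult[OF T1_div], symmetric])
  then have "poly ?p x = poly (?p div [:0, 2:]) x * poly [:0, 2:] x"
    by (metis poly_mult)
  also have "poly [:0, 2:] x = (2 * x)" by simp
  finally have *: "poly ?p x = poly (?p div [:0, 2:]) x * (2 * x)" .
  have "2 * x \<noteq> 0" using assms by simp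
  then have "poly (?p div [:0, 2:]) x = poly ?p x / (2 * x)"
    using * by (metis nonzero_mult_div_cancel_right)
  moreover have "poly ?p x = (t1 + u1 + x) * (t1 - u1 + x) * (poly f (- x) - poly f x)"
    by (simp only: poly_mult poly_diff poly_pcompose) simp
  ultimately show ?thesis
    by (simp only: T1_op_def poly_add poly_smult) simp
qed

lemma linear_smult_poly:
  "Vector_Spaces.linear Polynomial.smult Polynomial.smult (F :: complex poly \<Rightarrow> complex poly) \<longleftrightarrow>
    (\<forall>f g. F (f + g) = F f + F g) \<and>
    (\<forall>c f. F (Polynomial.smult c f) = Polynomial.smult c (F f))"
proof -
  have "vector_space (Polynomial.smult :: complex \<Rightarrow> complex poly \<Rightarrow> complex poly)"
    by unfold_locales (auto simp: smult_add_right smult_add_left)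
  then show ?thesis
    by (auto simp: Vector_Spaces.linear_def module_hom_def module_hom_axioms_def
        module_iff_vector_space)
qed

lemma T0_op_in_End: "T0_op t0 u0 \<in> carrier End_alg"
proof -
  define q where "q = [:t0 + u0 + 1/2, - 1:] * [:t0 - u0 + 1/2, - 1:]"
  define d where "d f = pcompose f [:1, - 1:] - f" for f :: "complex poly"
  have T: "T0_op t0 u0 f = Polynomial.smult t0 f + (q * d f) div [:1, - 2:]" for f
    by (simp only: T0_op_def q_def d_def)
  have d: "[:1, - 2:] dvd q * d f" for f
    unfolding d_def by (intro dvd_mult T0_div)
  have "q * d (f + g) = q * d f + q * d g" for f g
    by (simp add: d_def pcompose_add algebra_simps)
  moreover have "q * d (Polynomial.smult c f) = Polynomial.smult c (q * d f)" for c f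
    by (simp only: d_def pcompose_smult mult_smult_right[symmetric] smult_diff_right)
  ultimately show ?thesis
    by (simp add: End_alg_def linear_smult_poly T div_add[OF d d] smult_add_right div_smult_left
        mult.commute[of t0])
qed

lemma T1_op_in_End: "T1_op t1 u1 \<in> carrier End_alg"
proof -
  define q where "q = [:t1 + u1, 1:] * [:t1 - u1, 1:]"
  define d where "d f = pcompose f [:0, - 1:] - f" for f :: "complex poly"
  have T: "T1_op t1 u1 f = Polynomial.smult t1 f + (q * d f) div [:0, 2:]" for f
    by (simp only: T1_op_def q_def d_def)
  have d: "[:0, 2:] dvd q * d f" for f
    unfolding d_def by (intro dvd_mult T1_div)
  have "q * d (f + g) = q * d f + q * d g" for f g
    by (simp add: d_def pcompose_add algebra_simps)
  moreover have "q * d (Polynomial.smult c f) = Polynomial.smult c (q * d f)" for c f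
    by (simp only: d_def pcompose_smult mult_smult_right[symmetric] smult_diff_right)
  ultimately show ?thesis
    by (simp add: End_alg_def linear_smult_poly T div_add[OF d d] smult_add_right div_smult_left
        mult.commute[of t1])
qed

lemma z_op_in_End: "z_op \<in> carrier End_alg"
  by (simp add: End_alg_def linear_smult_poly z_op_def distrib_left smult_add_right)

lemma ring_End_alg: "ring End_alg"
proof (rule ringI)
  show "abelian_group End_alg"
  proof (rule abelian_groupI)
    fix F assume F: "F \<in> carrier End_alg"
    show "\<exists>G\<in>carrier End_alg. G \<oplus>\<^bsub>End_alg\<^esub> F = \<zero>\<^bsub>End_alg\<^esub>"
      using F by (intro bexI[of _ "\<lambda>f. - F f"]) (auto simp: End_alg_def linear_smult_poly)
  qed (auto simp: End_alg_def linear_smult_poly smult_add_right algebra_simps)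
  show "Group.monoid End_alg"
    by (rule monoidI) (auto simp: End_alg_def linear_smult_poly)
qed (auto simp: End_alg_def linear_smult_poly)

lemma unital_subalgebra_H_alg:
  "unital_subalgebra (carrier (H_alg t0 u0 t1 u1)) End_alg"
proof -
  interpret R: ring End_alg by (rule ring_End_alg)
  let ?X = "{T0_op t0 u0, T1_op t1 u1, z_op}"
  let ?\<S> = "{S. unital_subalgebra S End_alg \<and> ?X \<subseteq> S}"
  have "unital_subalgebra (carrier End_alg) End_alg"
    unfolding unital_subalgebra_def
    by (auto simp: R.carrier_is_subring) (auto simp: End_alg_def linear_smult_poly smult_add_right mult.commute)
  then have "carrier End_alg \<in> ?\<S>"
    using T0_op_in_End T1_op_in_End z_op_in_End by simp
  moreover from this have "subring (\<Inter>?\<S>) End_alg"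
    by (intro R.subring_Inter) (auto simp: unital_subalgebra_def)
  ultimately show ?thesis
    by (auto simp: H_alg_def generated_subalgebra_def unital_subalgebra_def)
qed

lemma ring_free_algebra: "ring free_algebra"
proof (rule ringI)
  show "abelian_group free_algebra"
    by (rule abelian_groupI) (auto simp: free_algebra_def algebra_simps intro: exI[of _ "- _"])
  show "Group.monoid free_algebra"
    by (rule monoidI) (auto simp: free_algebra_def algebra_simps)
qed (auto simp: free_algebra_def algebra_simps)

lemma ideal_rels: "ideal (Idl\<^bsub>free_algebra\<^esub> rels) free_algebra"
  by (rule ring.genideal_ideal[OF ring_free_algebra]) (simp add: free_algebra_def)

lemma presented_algebra_sel:
  "carrier (presented_algebra rels) = carrier (free_algebra Quot (Idl\<^bsub>free_algebra\<^esub> rels))"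
  "(\<otimes>\<^bsub>presented_algebra rels\<^esub>) = (\<otimes>\<^bsub>free_algebra Quot (Idl\<^bsub>free_algebra\<^esub> rels)\<^esub>)"
  "\<one>\<^bsub>presented_algebra rels\<^esub> = \<one>\<^bsub>free_algebra Quot (Idl\<^bsub>free_algebra\<^esub> rels)\<^esub>"
  "\<zero>\<^bsub>presented_algebra rels\<^esub> = \<zero>\<^bsub>free_algebra Quot (Idl\<^bsub>free_algebra\<^esub> rels)\<^esub>"
  "(\<oplus>\<^bsub>presented_algebra rels\<^esub>) = (\<oplus>\<^bsub>free_algebra Quot (Idl\<^bsub>free_algebra\<^esub> rels)\<^esub>)"
  by (simp_all add: presented_algebra_def quotient_algebra_def ring.defs module.defs)

lemma ring_presented_algebra: "ring (presented_algebra rels)"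
proof -
  interpret Q: ring "free_algebra Quot (Idl\<^bsub>free_algebra\<^esub> rels)"
    by (rule ideal.quotient_is_ring[OF ideal_rels])
  show ?thesis
  proof (rule ringI)
    show "abelian_group (presented_algebra rels)"
    proof (rule abelian_groupI)
      fix x assume "x \<in> carrier (presented_algebra rels)"
      then show "\<exists>y\<in>carrier (presented_algebra rels).
          y \<oplus>\<^bsub>presented_algebra rels\<^esub> x = \<zero>\<^bsub>presented_algebra rels\<^esub>"
        using Q.l_neg Q.a_inv_closed by (auto simp: presented_algebra_sel)
    qed (simp_all add: presented_algebra_sel Q.a_ac)
    show "Group.monoid (presented_algebra rels)"
      by (rule monoidI) (auto simp: presented_algebra_sel Q.m_assoc)
  qed (auto simp: presented_algebra_sel Q.l_distr Q.r_distr)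
qed

lemma presented_algebra_smult:
  fixes rels :: "('a free_mon \<Rightarrow>\<^sub>0 complex) set"
  defines "I \<equiv> Idl\<^bsub>free_algebra\<^esub> rels"
  shows "c \<odot>\<^bsub>presented_algebra rels\<^esub> (I +>\<^bsub>free_algebra\<^esub> x) =
    I +>\<^bsub>free_algebra\<^esub> (c \<odot>\<^bsub>free_algebra\<^esub> x)"
proof -
  interpret I: ideal I free_algebra unfolding I_def by (rule ideal_rels)
  have "I +>\<^bsub>free_algebra\<^esub> (c \<odot>\<^bsub>free_algebra\<^esub> y) = I +>\<^bsub>free_algebra\<^esub> (c \<odot>\<^bsub>free_algebra\<^esub> x)"
    if "y \<in> I +>\<^bsub>free_algebra\<^esub> x" for y
  proof -
    from that obtain h where h: "h \<in> I" "y = h + x"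
      by (auto simp: a_r_coset_def' free_algebra_def)
    have "scalar c * h \<in> I"
      using I.I_l_closed[OF h(1), of "scalar c"] by (simp add: free_algebra_def)
    then have "scalar c * y \<in> I +>\<^bsub>free_algebra\<^esub> (scalar c * x)"
      unfolding h(2) by (auto simp: a_r_coset_def' free_algebra_def distrib_left)
    then show ?thesis
      using I.a_repr_independence'[of "scalar c * y" "scalar c * x"]
      by (simp add: free_algebra_def)
  qed
  moreover have "x \<in> I +>\<^bsub>free_algebra\<^esub> x"
    using I.a_rcos_self[of x] by (simp add: free_algebra_def)
  ultimately have "(\<Union>y\<in>I +>\<^bsub>free_algebra\<^esub> x. I +>\<^bsub>free_algebra\<^esub> (c \<odot>\<^bsub>free_algebra\<^esub> y)) =
      I +>\<^bsub>free_algebra\<^esub> (c \<odot>\<^bsub>free_algebra\<^esub> x)"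
    by blast
  then show ?thesis
    by (simp add: presented_algebra_def quotient_algebra_def ring.defs module.defs I_def)
qed

end

theory Submission
  imports Defs
begin

text \<open>
  The defining relations say exactly that \<open>T\<^sub>i\<close> and \<open>U\<^sub>i\<close> satisfy the relations of \<open>\<V>(t)\<close>, so the
  evaluation homomorphism exists, and it is onto because \<open>z = T\<^sub>0 + U\<^sub>0 + 1/2\<close>. For injectivity put
  \<open>Z = V\<^sub>0 + Vt\<^sub>0 + 1/2\<close>. Modulo the relations, \<open>V\<^sub>1 Z = - Z V\<^sub>1 + (u\<^sub>1\<^sup>2 - t\<^sub>1\<^sup>2 - Z\<^sup>2)\<close> and
  \<open>V\<^sub>0 Z = (1 - Z) V\<^sub>0 + (Z - 1/2)\<^sup>2 + t\<^sub>0\<^sup>2 - u\<^sub>0\<^sup>2\<close>, so \<open>\<V>(t)\<close> is spanned over \<open>\<complex>[Z]\<close> by the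
  alternating words in \<open>V\<^sub>0\<close> and \<open>V\<^sub>1\<close>. A word of length \<open>k\<close> acts on \<open>f\<close> at a point \<open>x\<close> as a nonzero
  multiple of \<open>f(w x)\<close> plus values of \<open>f\<close> at orbit points of smaller length, where \<open>w\<close> is the
  corresponding element of the infinite dihedral group generated by \<open>x \<mapsto> 1 - x\<close> and \<open>x \<mapsto> - x\<close>.
  For \<open>x\<close> far from the real axis the orbit points are distinct, so a polynomial \<open>f\<close> that vanishes at
  all but one of them isolates each top coefficient of a vanishing combination.
\<close>

section \<open>Arithmetic in the free algebra and auxiliary facts\<close>

lemma free_algebra_sel [simp]:
  "carrier free_algebra = UNIV" "x \<otimes>\<^bsub>free_algebra\<^esub> y = x * y" "\<one>\<^bsub>free_algebra\<^esub> = 1"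
  "\<zero>\<^bsub>free_algebra\<^esub> = 0" "x \<oplus>\<^bsub>free_algebra\<^esub> y = x + y" "c \<odot>\<^bsub>free_algebra\<^esub> x = scalar c * x"
  by (simp_all add: free_algebra_def)

text \<open>Updating at a fresh key adds a monomial, so statements compatible with sums need
  checking on monomials only.\<close>

lemma poly_mapping_add_induct [case_names single add]:
  fixes p :: "'a \<Rightarrow>\<^sub>0 'b::comm_monoid_add"
  assumes single: "\<And>m c. P (Poly_Mapping.single m c)"
    and add: "\<And>p q. P p \<Longrightarrow> P q \<Longrightarrow> P (p + q)"
  shows "P p"
proof (induction p rule: update_induct)
  case const
  show ?case using single[of undefined 0] by simp
next
  case (update f a b)
  have "Poly_Mapping.update a b f = f + Poly_Mapping.single a b"
    using update(1)
    by (intro poly_mapping_eqI) (auto simp: lookup_update lookup_add lookup_single in_keys_iff when_def)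
  then show ?case using add update single by simp
qed

lemma scalar_0 [simp]: "scalar 0 = 0"
  and scalar_1 [simp]: "scalar 1 = 1"
  and scalar_add: "scalar (c + d) = scalar c + scalar d"
  and scalar_mult: "scalar (c * d) = scalar c * scalar d"
  and scalar_uminus: "scalar (- c) = - scalar c"
  and scalar_diff: "scalar (c - d) = scalar c - scalar d"
  by (simp_all add: scalar_def single_add mult_single single_uminus single_diff flip: single_one)

lemma scalar_commutes: "p * scalar c = scalar c * p"
  by (induction p rule: poly_mapping_add_induct)
    (simp_all add: scalar_def mult_single mult.commute distrib_left distrib_right)

lemma scalar_left_commutes: "p * (scalar c * q) = scalar c * (p * q)"
  by (metis scalar_commutes mult.assoc)

lemma single_Word_Cons:
  "Poly_Mapping.single (Word (a # w)) c = gen a * Poly_Mapping.single (Word w) (c :: complex)"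
  by (simp add: gen_def mult_single plus_free_mon_def)

lemma End_algD:
  assumes "F \<in> carrier End_alg"
  shows "F (f + g) = F f + F g" "F (Polynomial.smult c f) = Polynomial.smult c (F f)" "F 0 = 0"
proof -
  show "F (f + g) = F f + F g"
    using assms by (simp add: End_alg_def linear_smult_poly)
  show smult: "F (Polynomial.smult c f) = Polynomial.smult c (F f)" for c f
    using assms by (simp add: End_alg_def linear_smult_poly)
  show "F 0 = 0" using smult[of 0 0] by simp
qed

text \<open>The value formulas of the operators hold only off their poles; this lifts identities
  obtained from them to all polynomials.\<close>

lemma poly_eqI_cofinite:
  fixes p q :: "complex poly"
  assumes "finite S" "\<And>x. x \<notin> S \<Longrightarrow> poly p x = poly q x"
  shows "p = q"
proof (rule ccontr)
  assume "p \<noteq> q"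
  then have "finite (S \<union> {x. poly (p - q) x = 0})"
    using assms(1) poly_roots_finite[of "p - q"] by simp
  moreover have "S \<union> {x. poly (p - q) x = 0} = UNIV"
    using assms(2) by auto
  ultimately show False by (metis infinite_UNIV_char_0)
qed

section \<open>The reflections and their dihedral orbits\<close>

text \<open>Booleans index the two generators: \<^term>\<open>True\<close> stands for the index 0 and \<^term>\<open>False\<close> for 1.\<close>

definition centred :: "bool \<Rightarrow> complex \<Rightarrow> complex" where "centred b x = (if b then 1/2 - x else x)"

definition reflect :: "bool \<Rightarrow> complex \<Rightarrow> complex" where "reflect b x = (if b then 1 - x else - x)"

text \<open>\<open>centred b\<close> is a coordinate with origin at the fixed point of
  \<open>reflect b\<close>; in it both operators take the same form.\<close>

lemma centred_reflect [simp]: "centred b (reflect b x) = - centred b x"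
  by (simp add: centred_def reflect_def)

lemma reflect_reflect [simp]: "reflect b (reflect b x) = x"
  by (simp add: reflect_def)

lemma finite_centred: "finite {x. centred b x = 0}"
  by (rule finite_subset[of _ "{0, 1/2}"]) (auto simp: centred_def split: if_splits)

text \<open>The argument is reflected first, matching \<open>alt_word\<close>: the outermost
  operator evaluates the rest of the word at the reflected point.\<close>

fun orbit :: "bool \<Rightarrow> nat \<Rightarrow> complex \<Rightarrow> complex" where
  "orbit b 0 x = x"
| "orbit b (Suc k) x = orbit (\<not> b) k (reflect b x)"

text \<open>The composite of the two reflections is translation by 1 or -1, so even words are
  translations and odd ones are reflections.\<close>

lemma orbit_eq:
  "orbit b k x =
    (if b then (if even k then x - of_nat k / 2 else (of_nat k + 1) / 2 - x)
     else (if even k then x + of_nat k / 2 else - x - (of_nat k - 1) / 2))"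
  by (induction b k x rule: orbit.induct) (auto simp: reflect_def field_simps)

text \<open>The sign of the imaginary part determines the parity; the real part then determines
  length and first letter. The empty words of both letters agree, hence
  \<open>0 < k\<close>.\<close>

lemma orbit_inj:
  assumes "Im x \<noteq> 0" "orbit b k x = orbit c j x" "j \<le> k" "0 < k"
  shows "j = k" "c = b"
proof -
  have "even j = even k"
    using arg_cong[OF assms(2), of Im] assms(1) by (auto simp: orbit_eq split: if_splits)
  then have "j = k \<and> c = b"
    using arg_cong[OF assms(2), of Re] of_nat_mono[OF assms(3), where ?'a = real]
      assms(4)[folded of_nat_0_less_iff[where ?'a = real]]
    by (auto simp: orbit_eq field_simps split: if_splits)
  then show "j = k" "c = b" by auto
qed

section \<open>Polynomials in Z and alternating words\<close>

definition Z_elt :: "V_gen free_mon \<Rightarrow>\<^sub>0 complex" where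
  "Z_elt = gen V0 + gen Vt0 + scalar (1/2)"

definition V_elt :: "bool \<Rightarrow> (V_gen free_mon \<Rightarrow>\<^sub>0 complex)" where
  "V_elt b = gen (if b then V0 else V1)"

text \<open>Horner's scheme, because the coefficients are complex while the value lies in a
  noncommutative algebra.\<close>

definition at_Z :: "complex poly \<Rightarrow> (V_gen free_mon \<Rightarrow>\<^sub>0 complex)" where
  "at_Z q = fold_coeffs (\<lambda>a r. scalar a + Z_elt * r) q 0"

fun alt_word :: "bool \<Rightarrow> nat \<Rightarrow> (V_gen free_mon \<Rightarrow>\<^sub>0 complex)" where
  "alt_word b 0 = 1"
| "alt_word b (Suc k) = V_elt b * alt_word (\<not> b) k"

lemma at_Z_0 [simp]: "at_Z 0 = 0"
  by (simp add: at_Z_def)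

lemma at_Z_pCons [simp]: "at_Z (pCons a q) = scalar a + Z_elt * at_Z q"
  by (cases "a = 0 \<and> q = 0") (auto simp: at_Z_def)

lemma at_Z_add: "at_Z (p + q) = at_Z p + at_Z q"
  by (induction p q rule: poly_induct2) (simp_all add: scalar_add algebra_simps)

lemma at_Z_smult: "at_Z (Polynomial.smult c q) = scalar c * at_Z q"
  by (induction q) (simp_all add: scalar_mult scalar_left_commutes distrib_left)

lemma at_Z_mult: "at_Z (p * q) = at_Z p * at_Z q"
  by (induction p) (simp_all add: at_Z_add at_Z_smult algebra_simps)

section \<open>The quadratic relations for the operators\<close>

context
  fixes t0 u0 t1 u1 :: complex
begin

definition tpar :: "bool \<Rightarrow> complex" where "tpar b = (if b then t0 else t1)"

definition upar :: "bool \<Rightarrow> complex" where "upar b = (if b then u0 else u1)"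

definition weight :: "bool \<Rightarrow> complex \<Rightarrow> complex" where
  "weight b x = (tpar b + upar b + centred b x) * (tpar b - upar b + centred b x) / (2 * centred b x)"

definition T_op where "T_op b = (if b then T0_op t0 u0 else T1_op t1 u1)"

definition U_op where "U_op b = (if b then U0_op t0 u0 else U1_op t1 u1)"

lemma poly_T_op:
  assumes "centred b x \<noteq> 0"
  shows "poly (T_op b f) x =
    tpar b * poly f x + weight b x * (poly f (reflect b x) - poly f x)"
proof (cases b)
  case True
  then have "x \<noteq> 1/2" using assms by (auto simp: centred_def)
  moreover have "2 * (1/2 - x) = 1 - 2 * x" by simp
  ultimately show ?thesis using True
    by (simp add: T_op_def poly_T0_op tpar_def upar_def weight_def centred_def reflect_def algebra_simps)
next
  case False
  then show ?thesis using assms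
    by (simp add: T_op_def poly_T1_op tpar_def upar_def weight_def centred_def reflect_def)
qed

lemma poly_U_op: "poly (U_op b f) x = - poly (T_op b f) x - centred b x * poly f x"
  by (simp add: U_op_def T_op_def U0_op_def U1_op_def centred_def z_op_def algebra_simps)

text \<open>With y = \<open>centred b x\<close> the weight is ((t + y)^2 - u^2) / (2y), whose even
  part in y is t.\<close>

lemma weight_reflect:
  assumes "centred b x \<noteq> 0"
  shows "weight b (reflect b x) = 2 * tpar b - weight b x"
  using assms unfolding weight_def centred_reflect by (simp add: field_simps)

text \<open>On the values at \<open>x\<close> and \<open>reflect b x\<close> the operator is a 2 by
  2 matrix; by \<open>weight_reflect\<close> it has trace 0 and determinant -t^2.\<close>

lemma T_op_square: "T_op b (T_op b f) = Polynomial.smult ((tpar b)\<^sup>2) f"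
proof (rule poly_eqI_cofinite[OF finite_centred[of b]])
  fix x assume "x \<notin> {x. centred b x = 0}"
  then have x: "centred b x \<noteq> 0" by simp
  show "poly (T_op b (T_op b f)) x = poly (Polynomial.smult ((tpar b)\<^sup>2) f) x"
    using x by (simp add: poly_T_op weight_reflect algebra_simps power2_eq_square)
qed

lemma U_op_square: "U_op b (U_op b f) = Polynomial.smult ((upar b)\<^sup>2) f"
proof (rule poly_eqI_cofinite[OF finite_centred[of b]])
  fix x assume "x \<notin> {x. centred b x = 0}"
  then have x: "centred b x \<noteq> 0" by simp
  define y t u a A B where defs: "y = centred b x" "t = tpar b" "u = upar b"
    "a = weight b x" "A = poly f x" "B = poly f (reflect b x)"
  \<comment> \<open>The cleared denominator of the weight is what brings in u: the matrix of
    \<open>U_op b\<close> has trace 0 and determinant 2ya - (t + y)^2.\<close>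
  have a: "2 * y * a = (t + y)\<^sup>2 - u\<^sup>2"
    using x by (simp add: defs weight_def field_simps power2_eq_square)
  have "poly (U_op b (U_op b f)) x =
     - (t * (- (t * A + a * (B - A)) - y * A)
     + a * ((- (t * B + (2 * t - a) * (A - B)) + y * B) - (- (t * A + a * (B - A)) - y * A)))
     - y * (- (t * A + a * (B - A)) - y * A)"
    using x by (simp add: poly_T_op poly_U_op weight_reflect defs)
  also have "\<dots> = ((t + y)\<^sup>2 - 2 * y * a) * A"
    by (simp add: algebra_simps power2_eq_square)
  also have "\<dots> = u\<^sup>2 * A" by (simp add: a)
  finally show "poly (U_op b (U_op b f)) x = poly (Polynomial.smult ((upar b)\<^sup>2) f) x"
    by (simp add: defs)
qed

lemma T_op_in_End: "T_op b \<in> carrier End_alg"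
  by (simp add: T_op_def T0_op_in_End T1_op_in_End)

lemma U_op_in_End: "U_op b \<in> carrier End_alg"
  using T_op_in_End[of b]
  by (simp add: U_op_def T_op_def U0_op_def U1_op_def fun_eq_iff z_op_def End_alg_def linear_smult_poly
    smult_add_right distrib_left smult_diff_right mult.commute split: if_splits)

section \<open>Evaluation on the free algebra and the ideal of relations\<close>

primrec act :: "V_gen \<Rightarrow> complex poly \<Rightarrow> complex poly" where
  "act V0 = T0_op t0 u0"
| "act V1 = T1_op t1 u1"
| "act Vt0 = U0_op t0 u0"
| "act Vt1 = U1_op t1 u1"

lemma act_in_End: "act a \<in> carrier End_alg"
  using T_op_in_End[of True] T_op_in_End[of False] U_op_in_End[of True] U_op_in_End[of False]
  by (cases a) (simp_all add: T_op_def U_op_def)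

lemma foldr_act_in_End: "foldr act w \<in> carrier End_alg"
proof (induction w)
  case Nil
  then show ?case by (simp add: End_alg_def linear_smult_poly)
next
  case (Cons a w)
  then show ?case using act_in_End[of a] by (simp add: End_alg_def linear_smult_poly)
qed

text \<open>The evaluation homomorphism; \<open>foldr\<close> lets the first letter of a word act
  last, so products become compositions.\<close>

definition ev :: "(V_gen free_mon \<Rightarrow>\<^sub>0 complex) \<Rightarrow> complex poly \<Rightarrow> complex poly" where
  "ev p f = (\<Sum>m\<in>Poly_Mapping.keys p. Polynomial.smult (Poly_Mapping.lookup p m) (foldr act (letters m) f))"

lemma ev_add: "ev (p + q) f = ev p f + ev q f"
  unfolding ev_def by (rule setsum_keys_plus_distrib) (simp_all add: smult_add_left)

lemma ev_single: "ev (Poly_Mapping.single m c) f = Polynomial.smult c (foldr act (letters m) f)"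
  by (simp add: ev_def)

lemma ev_scalar [simp]: "ev (scalar c) f = Polynomial.smult c f"
  by (simp add: scalar_def ev_single zero_free_mon_def)

lemma ev_gen [simp]: "ev (gen a) = act a"
  by (simp add: gen_def ev_single fun_eq_iff)

lemma ev_0 [simp]: "ev 0 f = 0"
  by (simp add: ev_def)

lemma ev_1 [simp]: "ev 1 f = f"
  using ev_scalar[of 1 f] by simp

lemma ev_in_End: "ev p \<in> carrier End_alg"
proof (induction p rule: poly_mapping_add_induct)
  case (single m c)
  then show ?case using foldr_act_in_End[of "letters m"]
    by (simp add: End_alg_def linear_smult_poly ev_single smult_add_right mult.commute)
next
  case (add p q)
  then show ?case by (simp add: End_alg_def linear_smult_poly ev_add smult_add_right)
qed

lemma ev_uminus: "ev (- p) f = - ev p f"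
  using ev_add[of "- p" p f] by (simp add: eq_neg_iff_add_eq_0)

lemma ev_diff: "ev (p - q) f = ev p f - ev q f"
  using ev_add[of p "- q" f] by (simp add: ev_uminus)

lemma ev_mult: "ev (p * q) f = ev p (ev q f)"
proof (induction p rule: poly_mapping_add_induct)
  case (single m c)
  show ?case
  proof (induction q rule: poly_mapping_add_induct)
    case (single n d)
    then show ?case
      by (simp add: mult_single ev_single plus_free_mon_def End_algD[OF foldr_act_in_End])
  next
    case (add p q)
    then show ?case by (simp add: distrib_left ev_add End_algD[OF ev_in_End])
  qed
next
  case (add p q)
  then show ?case by (simp add: distrib_right ev_add)
qed

text \<open>The linear relation holds because T0 + U0 = z - 1/2 and T1 + U1 = -z.\<close>

lemma ev_rels:
  assumes "r \<in> V_rels t0 u0 t1 u1"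
  shows "ev r f = 0"
  using assms T_op_square[of True f] T_op_square[of False f] U_op_square[of True f] U_op_square[of False f]
  unfolding V_rels_def
  by (auto simp: power2_eq_square ev_diff ev_mult ev_add T_op_def U_op_def tpar_def upar_def
    scalar_uminus ev_uminus U0_op_def U1_op_def simp flip: smult_diff_left smult_add_left)

abbreviation rel_ideal :: "(V_gen free_mon \<Rightarrow>\<^sub>0 complex) set" where
  "rel_ideal \<equiv> Idl\<^bsub>free_algebra\<^esub> (V_rels t0 u0 t1 u1)"

lemma rel_ideal_rel: "r \<in> V_rels t0 u0 t1 u1 \<Longrightarrow> r \<in> rel_ideal"
  using ring.genideal_self[OF ring_free_algebra, of "V_rels t0 u0 t1 u1"] by auto

lemma rel_ideal_0: "0 \<in> rel_ideal"
  using additive_subgroup.zero_closed[OF ideal.axioms(1)[OF ideal_rels]] by simp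

lemma rel_ideal_add: "p \<in> rel_ideal \<Longrightarrow> q \<in> rel_ideal \<Longrightarrow> p + q \<in> rel_ideal"
  using additive_subgroup.a_closed[OF ideal.axioms(1)[OF ideal_rels]] by simp

lemma rel_ideal_mult_left: "p \<in> rel_ideal \<Longrightarrow> q * p \<in> rel_ideal"
  using ideal.I_l_closed[OF ideal_rels] by simp

lemma rel_ideal_mult_right: "p \<in> rel_ideal \<Longrightarrow> p * q \<in> rel_ideal"
  using ideal.I_r_closed[OF ideal_rels] by simp

lemma rel_ideal_diff: "p \<in> rel_ideal \<Longrightarrow> q \<in> rel_ideal \<Longrightarrow> p - q \<in> rel_ideal"
  using rel_ideal_add[of p "(- 1) * q"] rel_ideal_mult_left[of q "- 1"] by simp

text \<open>The elements killed by \<open>ev\<close> form an ideal containing the relations, hence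
  containing the ideal they generate.\<close>

lemma ev_rel_ideal:
  assumes "p \<in> rel_ideal"
  shows "ev p f = 0"
proof -
  have "ideal {p. \<forall>f. ev p f = 0} free_algebra"
  proof (rule idealI[OF ring_free_algebra])
    show "subgroup {p. \<forall>f. ev p f = 0} (add_monoid free_algebra)"
    proof (rule group.subgroupI)
      show "group (add_monoid free_algebra)"
        using abelian_group.a_group[OF ring.is_abelian_group[OF ring_free_algebra]] .
    next
      fix p assume "p \<in> {p. \<forall>f. ev p f = 0}"
      moreover have "inv\<^bsub>add_monoid free_algebra\<^esub> p = - p"
        using abelian_group.minus_equality[OF ring.is_abelian_group[OF ring_free_algebra], of "- p" p]
        by (simp add: a_inv_def)
      ultimately show "inv\<^bsub>add_monoid free_algebra\<^esub> p \<in> {p. \<forall>f. ev p f = 0}"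
        by (simp add: ev_uminus)
    qed (auto simp: ev_add intro: exI[of _ 0])
  qed (auto simp: ev_mult End_algD[OF ev_in_End])
  then show ?thesis
    using ring.genideal_minimal[OF ring_free_algebra, of "{p. \<forall>f. ev p f = 0}" "V_rels t0 u0 t1 u1"]
      ev_rels assms by auto
qed

section \<open>The image of evaluation\<close>

lemma H_alg_closed:
  defines "H \<equiv> carrier (H_alg t0 u0 t1 u1)"
  shows "id \<in> H" "F \<in> H \<Longrightarrow> G \<in> H \<Longrightarrow> F \<circ> G \<in> H"
    "F \<in> H \<Longrightarrow> G \<in> H \<Longrightarrow> (\<lambda>f. F f + G f) \<in> H"
    "F \<in> H \<Longrightarrow> (\<lambda>f. Polynomial.smult c (F f)) \<in> H"
    "T0_op t0 u0 \<in> H" "T1_op t1 u1 \<in> H" "z_op \<in> H"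
proof -
  have sub: "subring H End_alg" "\<forall>c. \<forall>F\<in>H. c \<odot>\<^bsub>End_alg\<^esub> F \<in> H"
    using unital_subalgebra_H_alg by (auto simp: H_def unital_subalgebra_def)
  show "id \<in> H" "F \<in> H \<Longrightarrow> G \<in> H \<Longrightarrow> F \<circ> G \<in> H"
    "F \<in> H \<Longrightarrow> G \<in> H \<Longrightarrow> (\<lambda>f. F f + G f) \<in> H"
    using subringE(3,6,7)[OF sub(1)] by (auto simp: End_alg_def)
  show "F \<in> H \<Longrightarrow> (\<lambda>f. Polynomial.smult c (F f)) \<in> H"
    using sub(2) by (auto simp: End_alg_def)
  show "T0_op t0 u0 \<in> H" "T1_op t1 u1 \<in> H" "z_op \<in> H"
    by (auto simp: H_def H_alg_def generated_subalgebra_def)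
qed

lemma act_in_H: "act a \<in> carrier (H_alg t0 u0 t1 u1)"
proof -
  have "(\<lambda>f. (Polynomial.smult (- 1) (T0_op t0 u0 f) + Polynomial.smult (- (1/2)) (id f)) + z_op f)
      \<in> carrier (H_alg t0 u0 t1 u1)"
    by (intro H_alg_closed)
  moreover have "(\<lambda>f. Polynomial.smult (- 1) (T1_op t1 u1 f) + Polynomial.smult (- 1) (z_op f))
      \<in> carrier (H_alg t0 u0 t1 u1)"
    by (intro H_alg_closed)
  ultimately show ?thesis
    by (cases a) (simp_all add: H_alg_closed U0_op_def[abs_def] U1_op_def[abs_def])
qed

lemma foldr_act_in_H: "foldr act w \<in> carrier (H_alg t0 u0 t1 u1)"
  by (induction w) (simp_all add: H_alg_closed(1)[unfolded id_def]
    H_alg_closed(2)[OF act_in_H, unfolded comp_def])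

lemma ev_in_H: "ev p \<in> carrier (H_alg t0 u0 t1 u1)"
proof (induction p rule: poly_mapping_add_induct)
  case (single m c)
  show ?case
    using H_alg_closed(4)[OF foldr_act_in_H, of c "letters m"] by (simp add: ev_single[abs_def])
next
  case (add p q)
  then show ?case using H_alg_closed(3)[OF add] by (simp add: ev_add[abs_def])
qed

lemma ev_Z_elt: "ev Z_elt = z_op"
  by (rule ext) (simp add: Z_elt_def ev_add U0_op_def)

text \<open>The image is a unital subalgebra containing T0, T1 and, through \<open>Z_elt\<close>,
  also z; minimality of the generated subalgebra gives the second inclusion.\<close>

lemma range_ev: "range ev = carrier (H_alg t0 u0 t1 u1)"
proof
  show "range ev \<subseteq> carrier (H_alg t0 u0 t1 u1)" using ev_in_H by (intro image_subsetI)
  interpret E: ring End_alg by (rule ring_End_alg)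
  have "subring (range ev) End_alg"
  proof (rule E.subringI)
    show "range ev \<subseteq> carrier End_alg" using ev_in_End by auto
    show "\<one>\<^bsub>End_alg\<^esub> \<in> range ev"
      by (rule range_eqI[of _ _ 1]) (simp add: End_alg_def fun_eq_iff)
    fix F G assume "F \<in> range ev" "G \<in> range ev"
    then obtain p q where pq: "F = ev p" "G = ev q" by auto
    have "ev (- p) \<oplus>\<^bsub>End_alg\<^esub> ev p = \<zero>\<^bsub>End_alg\<^esub>"
      by (simp add: End_alg_def ev_uminus)
    then have "\<ominus>\<^bsub>End_alg\<^esub> ev p = ev (- p)"
      using E.minus_equality ev_in_End by metis
    then show "\<ominus>\<^bsub>End_alg\<^esub> F \<in> range ev" by (simp add: pq)
    show "F \<otimes>\<^bsub>End_alg\<^esub> G \<in> range ev"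
      by (rule range_eqI[of _ _ "p * q"]) (simp add: pq End_alg_def fun_eq_iff ev_mult)
    show "F \<oplus>\<^bsub>End_alg\<^esub> G \<in> range ev"
      by (rule range_eqI[of _ _ "p + q"]) (simp add: pq End_alg_def fun_eq_iff ev_add)
  qed
  moreover have "c \<odot>\<^bsub>End_alg\<^esub> ev p \<in> range ev" for c p
    by (rule range_eqI[of _ _ "scalar c * p"]) (simp add: End_alg_def fun_eq_iff ev_mult)
  ultimately have "unital_subalgebra (range ev) End_alg"
    by (auto simp: unital_subalgebra_def)
  moreover have "T0_op t0 u0 \<in> range ev" "T1_op t1 u1 \<in> range ev" "z_op \<in> range ev"
    using rangeI[of ev "gen V0"] rangeI[of ev "gen V1"] rangeI[of ev Z_elt] by (simp_all add: ev_Z_elt)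
  ultimately show "carrier (H_alg t0 u0 t1 u1) \<subseteq> range ev"
    unfolding H_alg_def generated_subalgebra_def by simp (rule Inter_lower, simp)
qed

lemma ev_V_elt: "ev (V_elt b) = T_op b"
  by (simp add: V_elt_def T_op_def)

lemma ev_at_Z: "ev (at_Z q) f = q * f"
  by (induction q) (simp_all add: ev_add ev_mult ev_Z_elt z_op_def algebra_simps)

section \<open>Straightening and the filtration by word length\<close>

text \<open>\<open>V\<^sub>b q(Z)\<close> is straightened with \<open>V\<^sub>b Z = shift\<^sub>b(Z) V\<^sub>b + defect\<^sub>b(Z)\<close>, an identity modulo the relations.\<close>

definition shift :: "bool \<Rightarrow> complex poly" where
  "shift b = (if b then [:1, - 1:] else [:0, - 1:])"

definition defect :: "bool \<Rightarrow> complex poly" where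
  "defect b = (if b then [:1/4 + t0\<^sup>2 - u0\<^sup>2, - 1, 1:] else [:u1\<^sup>2 - t1\<^sup>2, 0, - 1:])"

lemma V_elt_square: "V_elt b * V_elt b - scalar ((tpar b)\<^sup>2) \<in> rel_ideal"
  by (rule rel_ideal_rel) (simp add: V_elt_def tpar_def V_rels_def power2_eq_square)

text \<open>Substitute Vt0 = Z - V0 - 1/2, or Vt1 = -Z - V1 modulo the linear relation, into the
  relation for its square and expand.\<close>

lemma V_elt_Z_elt: "V_elt b * Z_elt - (at_Z (shift b) * V_elt b + at_Z (defect b)) \<in> rel_ideal"
proof -
  define h where "h = (scalar (1/2) :: V_gen free_mon \<Rightarrow>\<^sub>0 complex)"
  have h: "p * h = h * p" "h * p + h * p = p" for p
  proof -
    show "p * h = h * p" by (simp add: h_def scalar_commutes)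
    have "h + h = 1" by (simp add: h_def flip: scalar_add)
    then show "h * p + h * p = p" by (metis distrib_right mult_1)
  qed
  have h2: "scalar (1/4) = h * h" by (simp add: h_def flip: scalar_mult)
  define a0 b0 a1 b1 where ab: "a0 = gen V0" "b0 = gen Vt0" "a1 = gen V1" "b1 = gen Vt1"
  define L where "L = a0 + a1 + b0 + b1 - scalar (- 1 / 2)"
  have "L \<in> rel_ideal" unfolding L_def ab by (rule rel_ideal_rel) (simp add: V_rels_def)
  have L: "L = a0 + a1 + b0 + b1 + h" by (simp add: L_def h_def flip: scalar_uminus)
  have sq: "a0 * a0 - scalar (t0\<^sup>2) \<in> rel_ideal" "a1 * a1 - scalar (t1\<^sup>2) \<in> rel_ideal"
    "b0 * b0 - scalar (u0\<^sup>2) \<in> rel_ideal" "b1 * b1 - scalar (u1\<^sup>2) \<in> rel_ideal"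
    unfolding ab by (rule rel_ideal_rel, simp add: V_rels_def power2_eq_square)+
  show ?thesis
  proof (cases b)
    case True
    have hZ: "Z_elt = a0 + b0 + h" by (simp add: Z_elt_def ab h_def)
    \<comment> \<open>The last two brackets vanish because h + h = 1.\<close>
    have "V_elt b * Z_elt - (at_Z (shift b) * V_elt b + at_Z (defect b)) =
        (a0 * a0 - scalar (t0\<^sup>2)) - (b0 * b0 - scalar (u0\<^sup>2))
        + (b0 - (h * b0 + h * b0)) + (h - (h * h + h * h))"
      using True
      by (simp add: shift_def defect_def V_elt_def scalar_add scalar_diff scalar_uminus h2 flip: ab)
        (simp add: hZ algebra_simps h(1)[of a0] h(1)[of b0])
    then show ?thesis using rel_ideal_diff[OF sq(1,3)] by (simp add: h(2))
  next
    case False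
    have hZ: "Z_elt = L - a1 - b1" by (simp add: Z_elt_def ab h_def L)
    \<comment> \<open>The relator \<open>L\<close> is not zero in the free algebra, so replacing Z
      by -a1 - b1 leaves the multiples of \<open>L\<close> displayed here.\<close>
    have "V_elt b * Z_elt - (at_Z (shift b) * V_elt b + at_Z (defect b)) =
        L * (L - b1) - b1 * L + (b1 * b1 - scalar (u1\<^sup>2)) - (a1 * a1 - scalar (t1\<^sup>2))"
      using False
      by (simp add: shift_def defect_def V_elt_def scalar_add scalar_diff scalar_uminus flip: ab)
        (simp add: hZ algebra_simps)
    then show ?thesis
      using \<open>L \<in> rel_ideal\<close> sq
      by (metis rel_ideal_add rel_ideal_diff rel_ideal_mult_left rel_ideal_mult_right)
  qed
qed

lemma V_elt_at_Z: "\<exists>q' r. V_elt b * at_Z q - (at_Z q' * V_elt b + at_Z r) \<in> rel_ideal"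
proof (induction q)
  case 0
  show ?case by (rule exI[of _ 0], rule exI[of _ 0]) (simp add: rel_ideal_0)
next
  case (pCons a q)
  then obtain q' r where IH: "V_elt b * at_Z q - (at_Z q' * V_elt b + at_Z r) \<in> rel_ideal" by blast
  have "V_elt b * at_Z (pCons a q) -
      (at_Z ([:a:] + shift b * q') * V_elt b + at_Z (shift b * r + defect b * q)) =
      (V_elt b * Z_elt - (at_Z (shift b) * V_elt b + at_Z (defect b))) * at_Z q
      + at_Z (shift b) * (V_elt b * at_Z q - (at_Z q' * V_elt b + at_Z r))"
    by (simp add: at_Z_add at_Z_mult) (simp add: algebra_simps scalar_commutes[of "V_elt b"])
  then show ?case
    using rel_ideal_add[OF rel_ideal_mult_right[OF V_elt_Z_elt] rel_ideal_mult_left[OF IH]] by metis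
qed

text \<open>Preimage in the free algebra of the \<complex>[Z]-span of the alternating words of
  length at most \<open>k\<close>; the rule \<open>ideal\<close> encodes passing to the
  quotient.\<close>

inductive_set filtration :: "nat \<Rightarrow> (V_gen free_mon \<Rightarrow>\<^sub>0 complex) set" for k where
  ideal: "p \<in> rel_ideal \<Longrightarrow> p \<in> filtration k"
| word: "j \<le> k \<Longrightarrow> at_Z q * alt_word b j \<in> filtration k"
| add: "p \<in> filtration k \<Longrightarrow> p' \<in> filtration k \<Longrightarrow> p + p' \<in> filtration k"

lemma filtration_mono:
  assumes "p \<in> filtration k" "k \<le> l"
  shows "p \<in> filtration l"
  using assms by (induction rule: filtration.induct) (auto intro: filtration.intros)

lemma filtration_at_Z:
  assumes "p \<in> filtration k"
  shows "at_Z r * p \<in> filtration k"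
  using assms
proof (induction rule: filtration.induct)
  case (word j q b)
  then show ?case using filtration.word[of j k "r * q" b] by (simp add: at_Z_mult mult.assoc)
qed (auto simp: distrib_left intro: filtration.intros rel_ideal_mult_left)

text \<open>Once moved past the coefficient, \<open>V_elt b\<close> either prolongs the word or
  meets the same letter, and then the square collapses to a scalar.\<close>

lemma filtration_V_elt:
  assumes "p \<in> filtration k"
  shows "V_elt b * p \<in> filtration (Suc k)"
  using assms
proof (induction rule: filtration.induct)
  case (word j q c)
  obtain q' r where qr: "V_elt b * at_Z q - (at_Z q' * V_elt b + at_Z r) \<in> rel_ideal"
    using V_elt_at_Z by blast
  have V_word: "V_elt b * alt_word c j \<in> filtration (Suc k)"
  proof (cases "j = 0 \<or> c \<noteq> b")
    case True
    then have "V_elt b * alt_word c j = at_Z 1 * alt_word b (Suc j)"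
      by (cases "j = 0") (auto simp: one_pCons)
    then show ?thesis using word filtration.word[of "Suc j" "Suc k" 1 b] by simp
  next
    case False
    then obtain i where i: "j = Suc i" "c = b" by (cases j) auto
    have "V_elt b * alt_word c j = (V_elt b * V_elt b - scalar ((tpar b)\<^sup>2)) * alt_word (\<not> b) i
        + at_Z [:(tpar b)\<^sup>2:] * alt_word (\<not> b) i"
      by (simp add: i algebra_simps)
    then show ?thesis
      using word filtration.ideal[OF rel_ideal_mult_right[OF V_elt_square]]
        filtration.word[of i "Suc k" "[:(tpar b)\<^sup>2:]"]
      by (auto simp: i intro: filtration.add)
  qed
  have "V_elt b * (at_Z q * alt_word c j) =
      (V_elt b * at_Z q - (at_Z q' * V_elt b + at_Z r)) * alt_word c j
      + (at_Z q' * (V_elt b * alt_word c j) + at_Z r * alt_word c j)"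
    by (simp add: algebra_simps)
  then show ?case
    using word rel_ideal_mult_right[OF qr] filtration_at_Z[OF V_word] filtration.word[of j "Suc k" r c]
    by (auto intro!: filtration.add intro: filtration.ideal)
qed (auto simp: distrib_left intro: filtration.intros rel_ideal_mult_left)

text \<open>Each tilded generator is a polynomial in Z minus the plain one: exactly for index 0, up
  to the linear relator for index 1.\<close>

lemma filtration_gen:
  assumes "p \<in> filtration k"
  shows "gen a * p \<in> filtration (Suc k)"
proof (cases a)
  case V0
  then show ?thesis using filtration_V_elt[OF assms, of True] by (simp add: V_elt_def)
next
  case V1
  then show ?thesis using filtration_V_elt[OF assms, of False] by (simp add: V_elt_def)
next
  case Vt0
  then have "gen a * p = at_Z [:- (1/2), 1:] * p + at_Z [:- 1:] * (V_elt True * p)"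
    by (simp add: V_elt_def Z_elt_def scalar_uminus algebra_simps)
  also have "\<dots> \<in> filtration (Suc k)"
    by (intro filtration.add filtration_at_Z filtration_mono[OF assms] filtration_V_elt assms) simp
  finally show ?thesis .
next
  case Vt1
  define L where "L = gen V0 + gen V1 + gen Vt0 + gen Vt1 - scalar (- 1 / 2)"
  have "L * p \<in> rel_ideal"
    unfolding L_def by (rule rel_ideal_mult_right, rule rel_ideal_rel) (simp add: V_rels_def)
  moreover have "gen a * p = L * p + (at_Z [:0, - 1:] * p + at_Z [:- 1:] * (V_elt False * p))"
    using Vt1 scalar_uminus[of "1/2"] by (simp add: L_def V_elt_def Z_elt_def scalar_uminus algebra_simps)
  moreover have "at_Z [:0, - 1:] * p + at_Z [:- 1:] * (V_elt False * p) \<in> filtration (Suc k)"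
    by (intro filtration.add filtration_at_Z filtration_mono[OF assms] filtration_V_elt assms) simp
  ultimately show ?thesis by (auto intro: filtration.intros)
qed

lemma filtration_exhaustive: "\<exists>k. p \<in> filtration k"
proof (induction p rule: poly_mapping_add_induct)
  case (single m c)
  have "\<exists>k. Poly_Mapping.single (Word w) c \<in> filtration k" for w :: "V_gen list"
  proof (induction w)
    case Nil
    have "Poly_Mapping.single (Word []) c = at_Z [:c:] * alt_word True 0"
      by (simp add: scalar_def zero_free_mon_def)
    then show ?case using filtration.word[of 0 0 "[:c:]" True] by (intro exI[of _ 0]) simp
  next
    case (Cons a w)
    then obtain k where "Poly_Mapping.single (Word w) c \<in> filtration k" by (elim exE)
    from filtration_gen[OF this, of a] show ?case unfolding single_Word_Cons by (rule exI)
  qed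
  from this[of "letters m"] show ?case by simp
next
  case (add p q)
  from add(1) obtain k where k: "p \<in> filtration k" by (elim exE)
  from add(2) obtain l where l: "q \<in> filtration l" by (elim exE)
  have "p + q \<in> filtration (max k l)"
    by (intro filtration.add filtration_mono[OF k] filtration_mono[OF l]) simp_all
  then show ?case by (rule exI)
qed

text \<open>At length 0 the two alternating words coincide, so a single coefficient remains.\<close>

lemma filtration_0D:
  assumes "p \<in> filtration 0"
  shows "\<exists>r\<in>rel_ideal. \<exists>q. p = r + at_Z q"
  using assms
proof (induction rule: filtration.induct)
  case (ideal p)
  then show ?case by (intro bexI[of _ p] exI[of _ 0]) auto
next
  case (word j q b)
  then show ?case by (intro bexI[of _ 0] exI[of _ q]) (auto simp: rel_ideal_0)
next
  case (add p p')
  then obtain r q r' q' where "r \<in> rel_ideal" "p = r + at_Z q" "r' \<in> rel_ideal" "p' = r' + at_Z q'"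
    by blast
  then show ?case
    by (intro bexI[of _ "r + r'"] exI[of _ "q + q'"]) (auto simp: at_Z_add rel_ideal_add)
qed

lemma filtration_SucD:
  assumes "p \<in> filtration (Suc k)"
  shows "\<exists>r\<in>filtration k. \<exists>q. p = r + (at_Z (q True) * alt_word True (Suc k)
    + at_Z (q False) * alt_word False (Suc k))"
  using assms
proof (induction rule: filtration.induct)
  case (ideal p)
  then show ?case by (intro bexI[of _ p] exI[of _ "\<lambda>_. 0"]) (auto intro: filtration.ideal)
next
  case (word j q b)
  show ?case
  proof (cases "j \<le> k")
    case True
    then show ?thesis
      by (intro bexI[of _ "at_Z q * alt_word b j"] exI[of _ "\<lambda>_. 0"]) (auto intro: filtration.word)
  next
    case False
    then have "j = Suc k" using word by simp
    then show ?thesis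
      by (intro bexI[of _ 0] exI[of _ "\<lambda>c. if c = b then q else 0"])
        (cases b, auto intro: filtration.ideal rel_ideal_0)
  qed
next
  case (add p p')
  then obtain r q r' q' where "r \<in> filtration k" "r' \<in> filtration k"
    "p = r + (at_Z (q True) * alt_word True (Suc k) + at_Z (q False) * alt_word False (Suc k))"
    "p' = r' + (at_Z (q' True) * alt_word True (Suc k) + at_Z (q' False) * alt_word False (Suc k))"
    by blast
  then show ?case
    by (intro bexI[of _ "r + r'"] exI[of _ "\<lambda>b. q b + q' b"])
      (auto simp: at_Z_add algebra_simps intro: filtration.add)
qed

section \<open>Leading terms at generic points\<close>

text \<open>
  Genericity is invariant under the dihedral group, puts \<open>x\<close> off the real axis and hence in a free
  orbit, and avoids the zeros and poles of the weights along that orbit.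
\<close>

definition generic :: "complex \<Rightarrow> bool" where
  "generic x \<longleftrightarrow> cmod t0 + cmod u0 + cmod t1 + cmod u1 < \<bar>Im x\<bar>"

lemma generic_reflect: "generic x \<Longrightarrow> generic (reflect b x)"
  by (simp add: generic_def reflect_def)

text \<open>The imaginary part of \<open>x\<close> outweighs those of t + u and t - u, so every
  factor of the weight has nonzero imaginary part.\<close>

lemma generic_nonzero:
  assumes "generic x"
  shows "Im x \<noteq> 0" "centred b x \<noteq> 0" "weight b x \<noteq> 0"
proof -
  note nonneg = norm_ge_zero[of t0] norm_ge_zero[of u0] norm_ge_zero[of t1] norm_ge_zero[of u1]
  show Im: "Im x \<noteq> 0" using assms nonneg unfolding generic_def by linarith
  have "Im (centred b x) \<noteq> 0" using Im by (simp add: centred_def)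
  then show c: "centred b x \<noteq> 0" by auto
  note Im_le = abs_Im_le_cmod[of t0] abs_Im_le_cmod[of u0] abs_Im_le_cmod[of t1] abs_Im_le_cmod[of u1]
  have "Im (tpar b + upar b + centred b x) \<noteq> 0" "Im (tpar b - upar b + centred b x) \<noteq> 0"
    using assms Im_le nonneg by (cases b; simp add: generic_def tpar_def upar_def centred_def)+
  then have "tpar b + upar b + centred b x \<noteq> 0" "tpar b - upar b + centred b x \<noteq> 0"
    by (metis zero_complex.sel(2))+
  then show "weight b x \<noteq> 0"
    using c by (simp add: weight_def)
qed

text \<open>Expanding the outermost operator leaves the shorter word at \<open>x\<close>, where it
  contributes 0, and at \<open>reflect b x\<close>, with factor \<open>weight b x\<close>. The order
  of quantifiers makes c independent of f.\<close>

lemma ev_alt_word_lead: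
  assumes "generic x"
  shows "\<exists>c. c \<noteq> 0 \<and> (\<forall>f. (\<forall>b'. \<forall>j<k. poly f (orbit b' j x) = 0) \<longrightarrow>
    poly (ev (alt_word b k) f) x = c * poly f (orbit b k x))"
  using assms
proof (induction k arbitrary: b x)
  case 0
  then show ?case by (intro exI[of _ 1]) simp
next
  case (Suc k)
  from Suc.IH[OF Suc.prems, of "\<not> b"] obtain c where c:
    "\<forall>f. (\<forall>b'. \<forall>j<k. poly f (orbit b' j x) = 0) \<longrightarrow>
      poly (ev (alt_word (\<not> b) k) f) x = c * poly f (orbit (\<not> b) k x)"
    by (elim exE conjE) (rule that)
  from Suc.IH[OF generic_reflect[OF Suc.prems, of b], of "\<not> b"] obtain d where d: "d \<noteq> 0"
    "\<forall>f. (\<forall>b'. \<forall>j<k. poly f (orbit b' j (reflect b x)) = 0) \<longrightarrow>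
      poly (ev (alt_word (\<not> b) k) f) (reflect b x) = d * poly f (orbit (\<not> b) k (reflect b x))"
    by (elim exE conjE) (rule that)
  have "poly (ev (alt_word b (Suc k)) f) x = weight b x * d * poly f (orbit b (Suc k) x)"
    if f: "\<forall>b'. \<forall>j<Suc k. poly f (orbit b' j x) = 0" for f
  proof -
    have "poly (ev (alt_word (\<not> b) k) f) x = 0"
      using c[THEN spec, of f] f by auto
    moreover have "poly f (orbit b' j (reflect b x)) = 0" if "j < k" for b' j
    \<comment> \<open>For b' = b the first reflection cancels \<open>reflect b\<close>; otherwise
      the two join to an alternating word of length j + 1 \<le> k.\<close>
    proof (cases "b' = b \<and> j \<noteq> 0")
      case True
      then obtain i where "j = Suc i" by (cases j) auto
      then show ?thesis using f True that by simp
    next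
      case False
      then have "orbit b' j (reflect b x) = orbit b (Suc j) x" by (cases "j = 0") auto
      then show ?thesis
        using f[THEN spec, of b, THEN spec, of "Suc j"] that by simp
    qed
    ultimately show ?thesis
      using generic_nonzero[OF Suc.prems] d(2)[THEN spec, of f] by (simp add: ev_mult ev_V_elt poly_T_op)
  qed
  then show ?case using generic_nonzero[OF Suc.prems] d(1) by (intro exI[of _ "weight b x * d"]) auto
qed

lemma ev_filtration_vanish:
  assumes "p \<in> filtration k" "generic x" "\<And>b j. j \<le> k \<Longrightarrow> poly f (orbit b j x) = 0"
  shows "poly (ev p f) x = 0"
  using assms(1)
proof (induction rule: filtration.induct)
  case (word j q b)
  obtain c where "\<forall>f. (\<forall>b'. \<forall>i<j. poly f (orbit b' i x) = 0) \<longrightarrow>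
      poly (ev (alt_word b j) f) x = c * poly f (orbit b j x)"
    using ev_alt_word_lead[OF assms(2)] by blast
  then show ?case using word assms(3) by (simp add: ev_mult ev_at_Z)
qed (simp_all add: ev_rel_ideal ev_add)

lemma top_coefficients_zero:
  assumes r: "r \<in> filtration k"
    and eq: "\<And>f. ev r f + (q True * ev (alt_word True (Suc k)) f
      + q False * ev (alt_word False (Suc k)) f) = 0"
  shows "q b = 0"
proof (rule ccontr)
  assume "q b \<noteq> 0"
  have root: "poly (q b) x = 0" if x: "generic x" for x
  proof -
    \<comment> \<open>All orbit points of length at most \<open>Suc k\<close> except the endpoint of
      the word under test; f vanishes exactly there and isolates q b at x.\<close>
    define P where "P = (\<Union>c. (\<lambda>j. orbit c j x) ` {..Suc k}) - {orbit b (Suc k) x}"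
    have fin: "finite P" by (simp add: P_def)
    define f where "f = (\<Prod>y\<in>P. [:- y, 1:])"
    have f: "poly f y = 0 \<longleftrightarrow> y \<in> P" for y
      using fin by (auto simp: f_def poly_prod)
    have inP: "orbit c j x \<in> P \<longleftrightarrow> \<not> (j = Suc k \<and> c = b)" if j: "j \<le> Suc k" for c j
    proof -
      have "orbit c j x \<in> P \<longleftrightarrow> orbit b (Suc k) x \<noteq> orbit c j x"
        using j by (auto simp: P_def simp del: orbit.simps)
      also have "\<dots> \<longleftrightarrow> \<not> (j = Suc k \<and> c = b)"
        using orbit_inj[OF generic_nonzero(1)[OF x] _ j] by blast
      finally show ?thesis .
    qed
    have "poly (ev r f) x = 0"
      using inP by (intro ev_filtration_vanish[OF r x]) (simp add: f)
    moreover have "poly (ev (alt_word c (Suc k)) f) x = 0 \<longleftrightarrow> c \<noteq> b" for c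
    proof -
      have "\<forall>b'. \<forall>j<Suc k. poly f (orbit b' j x) = 0"
        using inP by (simp add: f)
      then obtain d where "d \<noteq> 0" "poly (ev (alt_word c (Suc k)) f) x = d * poly f (orbit c (Suc k) x)"
        using ev_alt_word_lead[OF x, of "Suc k" c] by (elim exE conjE) metis
      then show ?thesis
        using inP[of "Suc k" c] by (simp add: f del: alt_word.simps orbit.simps)
    qed
    moreover have "poly (ev r f) x + (poly (q True) x * poly (ev (alt_word True (Suc k)) f) x
        + poly (q False) x * poly (ev (alt_word False (Suc k)) f) x) = 0"
      using arg_cong[OF eq[of f], of "\<lambda>p. poly p x"] by (simp only: poly_add poly_mult poly_0)
    ultimately show ?thesis
      by (cases b) (metis add_0 add_0_right mult_eq_0_iff)+
  qed
  \<comment> \<open>A horizontal line of generic points supplies infinitely many roots of q b; the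
    summand 1 makes the bound strict.\<close>
  define M where "M = cmod t0 + cmod u0 + cmod t1 + cmod u1 + 1"
  have "generic (Complex (of_nat n) M)" for n :: nat
    by (simp add: generic_def M_def)
  then have "range (\<lambda>n::nat. Complex (of_nat n) M) \<subseteq> {x. poly (q b) x = 0}"
    using root by auto
  moreover have "infinite (range (\<lambda>n::nat. Complex (of_nat n) M))"
    by (rule range_inj_infinite) (simp add: inj_on_def)
  ultimately show False
    using poly_roots_finite[OF \<open>q b \<noteq> 0\<close>] finite_subset by blast
qed

section \<open>The kernel of evaluation and the isomorphism\<close>

lemma ev_filtration_eq_0D:
  assumes "p \<in> filtration k" "\<And>f. ev p f = 0"
  shows "p \<in> rel_ideal"
  using assms
proof (induction k arbitrary: p)
  case 0
  then obtain r q where rq: "r \<in> rel_ideal" "p = r + at_Z q" using filtration_0D by blast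
  \<comment> \<open>Applied to the constant polynomial 1, \<open>at_Z q\<close> returns q
    itself.\<close>
  then have "q = 0"
    using "0.prems"(2)[of 1] by (simp add: ev_add ev_rel_ideal ev_at_Z)
  then show ?case using rq by simp
next
  case (Suc k)
  obtain r q where rq: "r \<in> filtration k" "p = r + (at_Z (q True) * alt_word True (Suc k)
      + at_Z (q False) * alt_word False (Suc k))"
    using filtration_SucD[OF Suc.prems(1)] by blast
  have "q b = 0" for b
    using Suc.prems(2) unfolding rq
    by (intro top_coefficients_zero[OF rq(1), of q]) (simp only: ev_add ev_mult ev_at_Z)
  then have "p = r" by (simp add: rq)
  then show ?case using Suc rq by simp
qed

lemma ev_kernel: "(\<forall>f. ev p f = 0) \<longleftrightarrow> p \<in> rel_ideal"
  using filtration_exhaustive[of p] ev_filtration_eq_0D ev_rel_ideal by blast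

lemma ring_hom_ring_ev: "ring_hom_ring free_algebra (H_alg t0 u0 t1 u1) ev"
proof (rule ring_hom_ringI[OF ring_free_algebra])
  have "subring (carrier (H_alg t0 u0 t1 u1)) End_alg"
    using unital_subalgebra_H_alg by (simp add: unital_subalgebra_def)
  then show "ring (H_alg t0 u0 t1 u1)"
    using ring.subring_is_ring[OF ring_End_alg]
    by (fastforce simp: H_alg_def generated_subalgebra_def)
next
  fix p
  show "ev p \<in> carrier (H_alg t0 u0 t1 u1)" by (rule ev_in_H)
qed (simp_all add: ev_mult ev_add H_alg_def generated_subalgebra_def End_alg_def fun_eq_iff)

lemma algebra_iso_V_H:
  "\<exists>\<phi> \<in> algebra_iso (V_alg t0 u0 t1 u1) (H_alg t0 u0 t1 u1).
    \<forall>a. \<phi> (presented_gen (V_rels t0 u0 t1 u1) a) = act a"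
proof -
  interpret ev: ring_hom_ring free_algebra "H_alg t0 u0 t1 u1" ev
    by (rule ring_hom_ring_ev)
  \<comment> \<open>\<open>ev\<close> is constant on cosets of its kernel, so the image of a coset
    is a singleton.\<close>
  define \<phi> where "\<phi> X = the_elem (ev ` X)" for X
  have ker: "a_kernel free_algebra (H_alg t0 u0 t1 u1) ev = rel_ideal"
    unfolding a_kernel_def' by (auto simp: H_alg_def generated_subalgebra_def End_alg_def fun_eq_iff
      simp flip: ev_kernel)
  have coset: "\<phi> (rel_ideal +>\<^bsub>free_algebra\<^esub> p) = ev p" for p
    using ev.the_elem_simp[of p] by (simp add: \<phi>_def ker)
  have "\<phi> \<in> ring_iso (free_algebra Quot rel_ideal) (H_alg t0 u0 t1 u1)"
    using ev.FactRing_iso_set range_ev by (simp add: ker \<phi>_def[abs_def])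
  then have "\<phi> \<in> ring_iso (V_alg t0 u0 t1 u1) (H_alg t0 u0 t1 u1)"
    by (simp add: ring_iso_def ring_hom_def V_alg_def presented_algebra_sel)
  \<comment> \<open>The first isomorphism theorem covers only the ring structure; scalars are
    checked on representatives.\<close>
  moreover have "\<phi> (c \<odot>\<^bsub>V_alg t0 u0 t1 u1\<^esub> X) = c \<odot>\<^bsub>H_alg t0 u0 t1 u1\<^esub> \<phi> X"
    if X: "X \<in> carrier (V_alg t0 u0 t1 u1)" for c X
  proof -
    obtain p where "X = rel_ideal +>\<^bsub>free_algebra\<^esub> p"
      using X by (auto simp: V_alg_def presented_algebra_sel FactRing_def A_RCOSETS_def')
    then show ?thesis
      by (simp add: V_alg_def presented_algebra_smult coset)
        (simp add: H_alg_def generated_subalgebra_def End_alg_def fun_eq_iff ev_mult)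
  qed
  ultimately have "\<phi> \<in> algebra_iso (V_alg t0 u0 t1 u1) (H_alg t0 u0 t1 u1)"
    by (simp add: algebra_iso_def)
  moreover have "\<phi> (presented_gen (V_rels t0 u0 t1 u1) a) = act a" for a
    by (simp add: presented_gen_def coset)
  ultimately show ?thesis by blast
qed

end

theorem proposition2p12:
  fixes t0 u0 t1 u1 :: complex
  assumes "t0 \<noteq> 0" and "t1 \<noteq> 0"
    and "t0 + t1 \<notin> {- (1/2) * of_nat n | n :: nat. n \<ge> 1}"
  shows "\<exists>\<phi> \<in> algebra_iso (V_alg t0 u0 t1 u1) (H_alg t0 u0 t1 u1).
    \<phi> (presented_gen (V_rels t0 u0 t1 u1) V0) = T0_op t0 u0 \<and>
    \<phi> (presented_gen (V_rels t0 u0 t1 u1) V1) = T1_op t1 u1 \<and>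
    \<phi> (presented_gen (V_rels t0 u0 t1 u1) Vt0) = U0_op t0 u0 \<and>
    \<phi> (presented_gen (V_rels t0 u0 t1 u1) Vt1) = U1_op t1 u1"
proof -
  obtain \<phi> where "\<phi> \<in> algebra_iso (V_alg t0 u0 t1 u1) (H_alg t0 u0 t1 u1)"
    "\<And>a. \<phi> (presented_gen (V_rels t0 u0 t1 u1) a) = act t0 u0 t1 u1 a"
    using algebra_iso_V_H by blast
  then show ?thesis by (intro bexI[of _ \<phi>]) (simp_all add: act.simps)
qed

end
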